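(* Let $(T,d)$ be a metric space with finite positive diameter, and let $r\ge4$, $\beta>0$. For each $k\in\mathbb Z$ let $\varphi_k:T\to\mathbb R^+$ be a map, such that $$\forall x\in T,\ \forall k\in\mathbb Z,\quad\varphi_k(x)\le\varphi_{k+1}(x);\qquad A=\sup\{\varphi_k(x):x\in T,\ k\in\mathbb Z\}<\infty .$$ Let $\theta:\{1,2,\dots\}\to\mathbb R^+$ satisfy $\lim_{n\to\infty}\theta(n)=\infty$. Assume that, given any $x\in T$, any $k\in\mathbb Z$, any $n\ge1$ and any points $y_1,\dots,y_n$ of $B(x,r^{-k})$ such that $d(y_i,y_j)\ge r^{-k-1}$ for all $i\ne j$, $i,j\le n$, we have $$\max_{j\le n}\varphi_{k+2}(y_j)\ge\varphi_k(x)+r^{-\beta k}\theta(n).$$ Let $k_0$ be the largest integer such that the diameter of $T$ is $\le r^{-k_0}$. Then one can find an increasing sequence of finite partitions $(\mathcal C_k)_{k\ge k_0}$ of $T$, and for each $C\in\mathcal C_k$ an integer index $\ell_k(C)\ge1$, such that: (i) each set $C$ of $\mathcal C_k$ has diameter $\le 2r^{-k}$; (ii) for any $k\ge k_0$ and any two distinct sets $C,D$ of $\mathcal C_{k+1}$ included in the same element of $\mathcal C_k$, we have $\ell_{k+1}(C)\ne\ell_{k+1}(D)$; (iii) denoting by $C_k(x)$ the unique element of $\mathcal C_k$ containing $x$, $$\forall x\in T,\quad\sum_{k\ge k_0}r^{-\beta k}\,\theta\big(\ell_{k+1}(C_{k+1}(x))\big)\le4A .$$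
   Context: $B(x,a)$ denotes the ball of $(T,d)$ centered at $x$ of radius $a$ (closed). A sequence of partitions is increasing if each element of $\mathcal C_{k+1}$ is contained in an element of $\mathcal C_k$. *)

theory Defs
  imports "HOL-Analysis.Analysis" "HOL-Library.Disjoint_Sets"
begin

(* Meaningful when P is a partition of a set containing x. *)
definition cell :: "'a set set \<Rightarrow> 'a \<Rightarrow> 'a set" where
  "cell P x = (THE C. C \<in> P \<and> x \<in> C)"

end

theory Submission
  imports Defs
begin

text \<open>
  A set \<open>C\<close> of level \<open>k\<close>, contained in the ball of radius \<open>r\<^sup>-\<^sup>k\<close> about \<open>x\<close>, is cut greedily:
  from what remains of \<open>C\<close> pick a point \<open>y\<^sub>n\<close> where \<open>\<phi>\<^sub>k\<^sub>+\<^sub>2\<close> is nearly minimal and split off the ball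
  of radius \<open>r\<^sup>-\<^sup>k\<^sup>-\<^sup>1\<close> about it as the piece with index \<open>n\<close>. The chosen points are separated, so the
  growth condition bounds their number because \<open>\<theta>\<close> tends to infinity. Near minimality gives
  \<open>\<phi>\<^sub>k\<^sub>+\<^sub>2 y\<^sub>j \<le> \<phi>\<^sub>k\<^sub>+\<^sub>2 z + \<epsilon>\<^sub>k\<close> for all \<open>j \<le> n\<close> and all \<open>z\<close> in the \<open>n\<close>-th piece, in particular for
  the centre \<open>z = t\<^sub>k\<^sub>+\<^sub>2\<close> of a set two levels below \<open>C\<close>. Hence along a branch with centres \<open>t\<^sub>k\<close>, the \<open>k\<close>-th term of
  the sum is at most \<open>\<phi>\<^sub>k\<^sub>+\<^sub>2 t\<^sub>k\<^sub>+\<^sub>2 - \<phi>\<^sub>k t\<^sub>k + \<epsilon>\<^sub>k\<close>. The even and odd levels telescope to at most \<open>A\<close> each,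
  and \<open>\<epsilon>\<^sub>k\<close> is chosen with total at most \<open>A\<close>.
\<close>

section \<open>Diameters and cells of partitions\<close>

lemma diameter_le_dist:
  fixes S :: "'a::metric_space set"
  assumes "S \<noteq> {}" and "\<And>x y. x \<in> S \<Longrightarrow> y \<in> S \<Longrightarrow> dist x y \<le> d"
  shows "diameter S \<le> d"
  using assms by (auto simp: diameter_def intro!: cSUP_least)

lemma cell_eq:
  assumes "partition_on T P" and "C \<in> P" and "x \<in> C"
  shows "cell P x = C"
  unfolding cell_def
proof (rule the_equality)
  show "D = C" if "D \<in> P \<and> x \<in> D" for D
    using that assms partition_onD2[OF assms(1)] by (auto simp: disjoint_def)
qed (use assms in auto)

lemma cell_in:
  assumes "partition_on T P" and "x \<in> T"
  shows "cell P x \<in> P" and "x \<in> cell P x"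
proof -
  obtain C where C: "C \<in> P" "x \<in> C"
    using assms partition_onD1 by blast
  then have "cell P x = C"
    by (rule cell_eq[OF assms(1)])
  with C show "cell P x \<in> P" "x \<in> cell P x"
    by auto
qed

text \<open>The slack is proportional to \<open>A\<close> so that it may vanish when \<open>A = 0\<close>; then \<open>f\<close> is zero.\<close>

lemma approx_min_exists:
  fixes f :: "'a \<Rightarrow> real"
  assumes "S \<noteq> {}" and "\<And>z. z \<in> S \<Longrightarrow> 0 \<le> f z" and "\<And>z. z \<in> S \<Longrightarrow> f z \<le> A" and "0 < \<delta>"
  shows "\<exists>y\<in>S. \<forall>z\<in>S. f y \<le> f z + A * \<delta>"
proof (cases "A > 0")
  case True
  have bdd: "bdd_below (f ` S)"
    using assms(2) by (auto intro!: bdd_belowI[of _ 0])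
  have "Inf (f ` S) < Inf (f ` S) + A * \<delta>"
    using True \<open>0 < \<delta>\<close> by simp
  then obtain y where y: "y \<in> S" "f y < Inf (f ` S) + A * \<delta>"
    using cInf_less_iff[of "f ` S" "Inf (f ` S) + A * \<delta>"] bdd assms(1) by auto
  have "f y \<le> f z + A * \<delta>" if "z \<in> S" for z
    using cInf_lower[OF _ bdd, of "f z"] that y(2) by auto
  then show ?thesis
    using y(1) by blast
next
  case False
  obtain y where y: "y \<in> S"
    using assms(1) by blast
  have "A = 0" "f z = 0" if "z \<in> S" for z
    using assms(2,3)[OF that] False by auto
  then show ?thesis
    using y by (intro bexI[of _ y]) auto
qed

text \<open>The remainders decrease, so a point of a later piece was still available when each
  earlier centre was picked; this gives the last clause. The family \<open>y\<close> asserted for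
  \<open>D\<close> consists of the first \<open>l D\<close> centres. The hypothesis
  \<open>bound\<close> forces the process to stop.\<close>

lemma greedy_ball_partition:
  fixes f :: "'a::metric_space \<Rightarrow> real" and a \<epsilon> :: real and N :: nat
  assumes a: "0 \<le> a"
    and min: "\<And>S. S \<subseteq> C \<Longrightarrow> S \<noteq> {} \<Longrightarrow> \<exists>y\<in>S. \<forall>z\<in>S. f y \<le> f z + \<epsilon>"
    and bound: "\<And>n y. (\<And>i. i \<in> {1..n} \<Longrightarrow> y i \<in> C) \<Longrightarrow>
      (\<And>i j. i \<in> {1..n} \<Longrightarrow> j \<in> {1..n} \<Longrightarrow> i \<noteq> j \<Longrightarrow> a \<le> dist (y i) (y j)) \<Longrightarrow> n \<le> N"
  obtains Q c l where "finite Q" and "partition_on C Q" and "inj_on l Q"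
    and "\<forall>D\<in>Q. c D \<in> D \<and> D \<subseteq> cball (c D) a \<and> (1::nat) \<le> l D \<and>
      (\<exists>y. (\<forall>i\<in>{1..l D}. y i \<in> C) \<and>
        (\<forall>i\<in>{1..l D}. \<forall>j\<in>{1..l D}. i \<noteq> j \<longrightarrow> a \<le> dist (y i) (y j)) \<and>
        (\<forall>z\<in>D. \<forall>i\<in>{1..l D}. f (y i) \<le> f z + \<epsilon>))"
proof -
  define pick where "pick S = (SOME y. y \<in> S \<and> (\<forall>z\<in>S. f y \<le> f z + \<epsilon>))" for S
  have pick: "pick S \<in> S" "z \<in> S \<Longrightarrow> f (pick S) \<le> f z + \<epsilon>" if "S \<subseteq> C" "S \<noteq> {}" for S z
    using someI_ex[of "\<lambda>y. y \<in> S \<and> (\<forall>z\<in>S. f y \<le> f z + \<epsilon>)"] min[OF that]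
    unfolding pick_def by blast+
  define R where "R = rec_nat C (\<lambda>_ S. S - cball (pick S) a)"
  have R_0: "R 0 = C" and R_Suc: "R (Suc n) = R n - cball (pick (R n)) a" for n
    by (simp_all add: R_def)
  have R_mono: "R n \<subseteq> R m" if "m \<le> n" for m n
    by (rule lift_Suc_antimono_le[OF _ that]) (auto simp: R_Suc)
  have R_C: "R n \<subseteq> C" for n
    using R_mono[of 0 n] by (simp add: R_0)
  \<comment> \<open>Stages are counted from 1, since the indices must be at least 1. Hence the
    shift: stage \<open>i\<close> works in \<open>R (i - 1)\<close>, the remainder after
    \<open>i - 1\<close> removals.\<close>
  define y where "y i = pick (R (i - 1))" for i
  define B where "B i = R (i - 1) \<inter> cball (y i) a" for i
  have R_diff: "R i = R (i - 1) - B i" if "1 \<le> i" for i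
    using R_Suc[of "i - 1"] that by (auto simp: B_def y_def)
  \<comment> \<open>Closed balls are removed, so whatever remains is strictly farther than
    \<open>a\<close> from every earlier centre.\<close>
  have R_far: "a < dist (y i) z" if "1 \<le> i" "i \<le> m" "z \<in> R m" for i m z
    using R_diff[OF that(1)] R_mono[OF that(2)] R_mono[of "i - 1" i] that(3)
    by (auto simp: B_def)
  have y_R: "y i \<in> R (i - 1)" if "R (i - 1) \<noteq> {}" for i
    using pick(1)[OF R_C that] by (simp add: y_def)
  have sep: "a < dist (y i) (y j)" if "1 \<le> i" "i < j" "R (j - 1) \<noteq> {}" for i j
    using R_far[OF that(1) _ y_R[OF that(3)]] that(2) by simp
  \<comment> \<open>If something is left after \<open>n - 1\<close> removals, then also after fewer,
    so \<open>y 1\<close>, ..., \<open>y n\<close> are all genuine choices and not values of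
    \<open>pick\<close> at the empty set.\<close>
  have sep': "a \<le> dist (y i) (y j)" if "1 \<le> i" "1 \<le> j" "i \<noteq> j" "i \<le> n" "j \<le> n" "R (n - 1) \<noteq> {}" for i j n
  proof -
    have "R (i - 1) \<noteq> {}" "R (j - 1) \<noteq> {}"
      using R_mono[of "i - 1" "n - 1"] R_mono[of "j - 1" "n - 1"] that by auto
    then show ?thesis
      using sep[of i j] sep[of j i] that(1-3) by (cases i j rule: linorder_cases) (auto simp: dist_commute)
  qed
  have y_C: "y i \<in> C" if "1 \<le> i" "i \<le> n" "R (n - 1) \<noteq> {}" for i n
  proof -
    have "R (i - 1) \<noteq> {}"
      using R_mono[of "i - 1" "n - 1"] that by auto
    then show ?thesis
      using y_R R_C by blast
  qed
  have ex: "\<exists>n. R n = {}"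
  proof (rule ccontr)
    assume "\<not> ?thesis"
    \<comment> \<open>If no remainder were empty, the first \<open>N + 1\<close> centres would be a
      separated family that is too large.\<close>
    then have "Suc N \<le> N"
      by (intro bound[of "Suc N" y]) (auto intro: y_C[of _ "Suc N"] sep'[of _ _ "Suc N"])
    then show False by simp
  qed
  define n where "n = (LEAST n. R n = {})"
  have R_n: "R n = {}"
    unfolding n_def using ex by (rule LeastI_ex)
  \<comment> \<open>As \<open>n\<close> is the first stage with empty remainder, each piece up to
    \<open>n\<close> is cut from a nonempty set and contains its centre.\<close>
  have R_ne: "R (i - 1) \<noteq> {}" if "i \<in> {1..n}" for i
    using not_less_Least[of "i - 1" "\<lambda>n. R n = {}"] that
    by (fastforce simp flip: n_def)
  have y_B: "y i \<in> B i" if "i \<in> {1..n}" for i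
    using y_R[OF R_ne[OF that]] a by (simp add: B_def)
  have B_R: "B j \<subseteq> R i" if "i < j" for i j
  proof -
    have "i \<le> j - 1"
      using that by simp
    then show ?thesis
      using R_mono unfolding B_def by blast
  qed
  have B_disj: "B i \<inter> B j = {}" if "1 \<le> i" "i < j" for i j
    using B_R[OF that(2)] R_diff[OF that(1)] by blast
  have B_eq: "i = j" if "i \<in> {1..n}" "j \<in> {1..n}" "B i \<inter> B j \<noteq> {}" for i j
    using B_disj[of i j] B_disj[of j i] that by (cases i j rule: linorder_cases) auto
  have inj: "inj_on B {1..n}"
    using B_eq y_B by (intro inj_onI) blast
  have cover: "C \<subseteq> (\<Union>i\<in>{1..m}. B i) \<union> R m" for m
  proof (induction m)
    case 0
    then show ?case by (simp add: R_0)
  next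
    case (Suc m)
    then show ?case
      using R_diff[of "Suc m"] by (auto simp: atLeastAtMostSuc_conv)
  qed
  \<comment> \<open>The pieces are nonempty and disjoint, so the stage can be recovered from the
    piece as a set.\<close>
  define l where "l = inv_into {1..n} B"
  have l: "l (B i) = i" if "i \<in> {1..n}" for i
    using inj that by (simp add: l_def)
  have part: "partition_on C (B ` {1..n})"
  proof (rule partition_onI)
    show "\<Union> (B ` {1..n}) = C"
      using cover[of n] R_n R_C by (auto simp: B_def)
    show "disjnt p q" if "p \<in> B ` {1..n}" "q \<in> B ` {1..n}" "p \<noteq> q" for p q
      using that B_eq unfolding disjnt_def by blast
    show "{} \<notin> B ` {1..n}"
      using y_B by blast
  qed
  have f_le: "f (y i) \<le> f z + \<epsilon>" if "i \<in> {1..j}" "j \<in> {1..n}" "z \<in> B j" for i j z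
  proof -
    \<comment> \<open>The piece \<open>B j\<close> lies in \<open>R (i - 1)\<close>, the set on
      which \<open>y i\<close> was chosen nearly minimal.\<close>
    have "i - 1 < j"
      using that(1) by auto
    then have "z \<in> R (i - 1)"
      using B_R that(3) by blast
    then show ?thesis
      using pick(2)[OF R_C, of "i - 1" z] by (auto simp: y_def)
  qed
  show thesis
  proof (rule that[of "B ` {1..n}" l "y \<circ> l"])
    show "finite (B ` {1..n})" by simp
    show "partition_on C (B ` {1..n})" by (rule part)
    show "inj_on l (B ` {1..n})"
      using l by (auto intro!: inj_onI)
    show "\<forall>D\<in>B ` {1..n}. ((y \<circ> l) D \<in> D \<and> D \<subseteq> cball ((y \<circ> l) D) a \<and> 1 \<le> l D \<and>
      (\<exists>y. (\<forall>i\<in>{1..l D}. y i \<in> C) \<and>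
        (\<forall>i\<in>{1..l D}. \<forall>j\<in>{1..l D}. i \<noteq> j \<longrightarrow> a \<le> dist (y i) (y j)) \<and>
        (\<forall>z\<in>D. \<forall>i\<in>{1..l D}. f (y i) \<le> f z + \<epsilon>)))"
    proof (intro ballI conjI exI[of _ y] impI)
      fix D assume "D \<in> B ` {1..n}"
      then obtain m where m: "m \<in> {1..n}" "D = B m" "l D = m"
        using l by auto
      show "(y \<circ> l) D \<in> D" using m y_B by simp
      show "D \<subseteq> cball ((y \<circ> l) D) a"
        using m by (auto simp: B_def)
      show "1 \<le> l D" using m by simp
      show "y i \<in> C" if "i \<in> {1..l D}" for i
        using that m R_ne[OF m(1)] y_C[of i m] by auto
      show "a \<le> dist (y i) (y j)" if "i \<in> {1..l D}" "j \<in> {1..l D}" "i \<noteq> j" for i j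
        using that m R_ne[OF m(1)] sep'[of i j m] by auto
      show "f (y i) \<le> f z + \<epsilon>" if "z \<in> D" "i \<in> {1..l D}" for z i
        using that m f_le[of i m z] by auto
    qed
  qed
qed

text \<open>The partitions chosen for the separate members of \<open>P\<close> are united. Their
  centres and labels are given per parent; a nonempty piece has only one parent, so they merge into
  functions of the piece alone. The relation \<open>R\<close> is left abstract to carry over any
  property of parent, piece, centre and label.\<close>

lemma partition_refine_each:
  assumes part: "partition_on T P" and "finite P"
    and each: "\<And>C. C \<in> P \<Longrightarrow> \<exists>Q c l. finite Q \<and> partition_on C Q \<and> inj_on l Q \<and>
      (\<forall>D\<in>Q. R C D (c D) (l D))"
  shows "\<exists>P' c l. finite P' \<and> refines T P' P \<and>
    (\<forall>C\<in>P. inj_on l {D\<in>P'. D \<subseteq> C} \<and> (\<forall>D\<in>P'. D \<subseteq> C \<longrightarrow> R C D (c D) (l D)))"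
proof -
  obtain Q c l where Q: "\<And>C. C \<in> P \<Longrightarrow> finite (Q C) \<and> partition_on C (Q C) \<and> inj_on (l C) (Q C) \<and>
      (\<forall>D\<in>Q C. R C D (c C D) (l C D))"
    using each by metis
  define P' where "P' = (\<Union>C\<in>P. Q C)"
  \<comment> \<open>For a piece in \<open>P'\<close> this choice is forced, because the piece is
    nonempty and the members of \<open>P\<close> are disjoint.\<close>
  define up where "up D = (SOME C. C \<in> P \<and> D \<subseteq> C)" for D
  have Q_sub: "D \<subseteq> C" "D \<noteq> {}" if "C \<in> P" "D \<in> Q C" for C D
    using Q[OF that(1)] that(2) by (auto simp: partition_on_def)
  have eq: "C = C'" if "C \<in> P" "C' \<in> P" "x \<in> C" "x \<in> C'" for C C' x
    using that partition_onD2[OF part] by (auto simp: disjoint_def)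
  have P': "D \<noteq> {} \<and> D \<in> Q C \<and> up D = C" if "C \<in> P" "D \<in> P'" "D \<subseteq> C" for C D
  proof -
    obtain C' where C': "C' \<in> P" "D \<in> Q C'"
      using \<open>D \<in> P'\<close> by (auto simp: P'_def)
    have "D \<noteq> {}" "D \<subseteq> C'"
      using Q_sub[OF C'] by auto
    moreover have "up D \<in> P \<and> D \<subseteq> up D"
      unfolding up_def by (rule someI[of _ C]) (use that in auto)
    ultimately have "C' = C" "up D = C"
      using eq that C'(1) by blast+
    then show ?thesis
      using C' \<open>D \<noteq> {}\<close> by simp
  qed
  have "partition_on T P'"
  proof (rule partition_onI)
    show "\<Union> P' = T"
      using Q partition_onD1[OF part] by (fastforce simp: P'_def partition_on_def)
    show "{} \<notin> P'"
      using Q_sub(2) by (auto simp: P'_def)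
    show "disjnt D E" if DE: "D \<in> P'" "E \<in> P'" "D \<noteq> E" for D E
    proof (rule ccontr)
      assume "\<not> disjnt D E"
      then obtain x where x: "x \<in> D" "x \<in> E"
        by (auto simp: disjnt_def)
      obtain C C' where C: "C \<in> P" "D \<in> Q C" "C' \<in> P" "E \<in> Q C'"
        using DE by (auto simp: P'_def)
      then have "C = C'"
        using eq x Q_sub(1) by blast
      then have "D = E"
        using Q[OF C(1)] C x unfolding partition_on_def disjoint_def by blast
      then show False using DE by simp
    qed
  qed
  then have "refines T P' P"
    using part Q_sub(1) by (auto simp: refines_def P'_def)
  moreover have "finite P'"
    using Q \<open>finite P\<close> by (auto simp: P'_def)
  moreover have "inj_on (\<lambda>D. l (up D) D) {D\<in>P'. D \<subseteq> C} \<and>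
      (\<forall>D\<in>P'. D \<subseteq> C \<longrightarrow> R C D (c (up D) D) (l (up D) D))" if "C \<in> P" for C
  proof (intro conjI ballI impI)
    show "inj_on (\<lambda>D. l (up D) D) {D\<in>P'. D \<subseteq> C}"
    proof (rule inj_onI)
      fix D E assume "D \<in> {D\<in>P'. D \<subseteq> C}" "E \<in> {D\<in>P'. D \<subseteq> C}" "l (up D) D = l (up E) E"
      then show "D = E"
        using P'[OF that, of D] P'[OF that, of E] Q[OF that] by (auto dest: inj_onD)
    qed
    show "R C D (c (up D) D) (l (up D) D)" if "D \<in> P'" "D \<subseteq> C" for D
      using P'[OF \<open>C \<in> P\<close> that] Q[OF \<open>C \<in> P\<close>] by auto
  qed
  ultimately show ?thesis
    by (intro exI[of _ P'] exI[of _ "\<lambda>D. c (up D) D"] exI[of _ "\<lambda>D. l (up D) D"]) blast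
qed

text \<open>Every finite subset of \<open>{k0..}\<close> lies in an initial segment, so for
  nonnegative terms the bound on initial segments bounds all finite sums. This passes from levels
  counted by naturals to the unordered sum over integers.\<close>

lemma summable_on_infsum_le_int_atLeast:
  fixes f :: "int \<Rightarrow> real"
  assumes nonneg: "\<And>k. k0 \<le> k \<Longrightarrow> 0 \<le> f k"
    and bound: "\<And>M::nat. (\<Sum>m<M. f (k0 + int m)) \<le> b"
  shows "f summable_on {k0..}" and "infsum f {k0..} \<le> b"
proof -
  have fin: "sum f F \<le> b" if F: "finite F" "F \<subseteq> {k0..}" for F
  proof -
    obtain M where M: "\<And>k. k \<in> F \<Longrightarrow> nat (k - k0) < M"
      using finite_nat_bounded[of "(\<lambda>k. nat (k - k0)) ` F"] F(1) by auto
    have "F \<subseteq> (\<lambda>m. k0 + int m) ` {..<M}"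
    proof
      fix k assume "k \<in> F"
      then show "k \<in> (\<lambda>m. k0 + int m) ` {..<M}"
        using M F(2) by (intro image_eqI[of _ _ "nat (k - k0)"]) auto
    qed
    then have "sum f F \<le> sum f ((\<lambda>m. k0 + int m) ` {..<M})"
      by (intro sum_mono2) (auto intro: nonneg)
    also have "\<dots> = (\<Sum>m<M. f (k0 + int m))"
      by (subst sum.reindex) (auto simp: inj_on_def)
    finally show ?thesis
      using bound[of M] by linarith
  qed
  show summable: "f summable_on {k0..}"
    using nonneg fin by (intro nonneg_bdd_above_summable_on bdd_aboveI2[of _ _ b]) auto
  show "infsum f {k0..} \<le> b"
    using fin by (intro infsum_le_finite_sums[OF summable])
qed

lemma sum_telescope_two:
  fixes g :: "nat \<Rightarrow> real"
  shows "(\<Sum>m<M. g (m + 2) - g m) = g M + g (Suc M) - g 0 - g 1"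
  by (induction M) (simp_all add: numeral_2_eq_2)


theorem theorem2p1:
  fixes T :: "'a::metric_space set"
    and r \<beta> A :: real
    and \<phi> :: "int \<Rightarrow> 'a \<Rightarrow> real"
    and \<theta> :: "nat \<Rightarrow> real"
    and k0 :: int
  assumes "bounded T" and "diameter T > 0"
    and "r \<ge> 4" and "\<beta> > 0"
    and "\<And>k x. x \<in> T \<Longrightarrow> \<phi> k x \<ge> 0"
    and "\<And>k x. x \<in> T \<Longrightarrow> \<phi> k x \<le> \<phi> (k + 1) x"
    and "bdd_above {\<phi> k x | k x. x \<in> T}"
    and "A = Sup {\<phi> k x | k x. x \<in> T}"
    and "\<And>n. n \<ge> 1 \<Longrightarrow> \<theta> n \<ge> 0"
    and "filterlim \<theta> at_top sequentially"
    and "\<And>x k n (y :: nat \<Rightarrow> 'a).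
           \<lbrakk> x \<in> T; n \<ge> 1;
             \<And>i. i \<in> {1..n} \<Longrightarrow> y i \<in> cball x (r powi (-k)) \<inter> T;
             \<And>i j. \<lbrakk> i \<in> {1..n}; j \<in> {1..n}; i \<noteq> j \<rbrakk> \<Longrightarrow> dist (y i) (y j) \<ge> r powi (-k - 1) \<rbrakk>
           \<Longrightarrow> Max ((\<lambda>j. \<phi> (k + 2) (y j)) ` {1..n}) \<ge> \<phi> k x + r powr (- \<beta> * of_int k) * \<theta> n"
    and "diameter T \<le> r powi (-k0)"
    and "\<And>k. diameter T \<le> r powi (-k) \<Longrightarrow> k \<le> k0"
  shows "\<exists>(\<C> :: int \<Rightarrow> 'a set set) (l :: int \<Rightarrow> 'a set \<Rightarrow> nat).
           (\<forall>k\<ge>k0. finite (\<C> k) \<and> partition_on T (\<C> k)) \<and>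
           (\<forall>k\<ge>k0. refines T (\<C> (k + 1)) (\<C> k)) \<and>
           (\<forall>k\<ge>k0. \<forall>C\<in>\<C> k. l k C \<ge> 1) \<and>
           (\<forall>k\<ge>k0. \<forall>C\<in>\<C> k. diameter C \<le> 2 * r powi (-k)) \<and>
           (\<forall>k\<ge>k0. \<forall>E\<in>\<C> k. \<forall>C\<in>\<C> (k + 1). \<forall>D\<in>\<C> (k + 1).
              C \<noteq> D \<and> C \<subseteq> E \<and> D \<subseteq> E \<longrightarrow> l (k + 1) C \<noteq> l (k + 1) D) \<and>
           (\<forall>x\<in>T.
              (\<lambda>k. r powr (- \<beta> * of_int k) * \<theta> (l (k + 1) (cell (\<C> (k + 1)) x))) summable_on {k0..} \<and>
              (\<Sum>\<^sub>\<infinity>k\<in>{k0..}. r powr (- \<beta> * of_int k) * \<theta> (l (k + 1) (cell (\<C> (k + 1)) x))) \<le> 4 * A)"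
proof -

  \<comment> \<open>Bounds on \<phi> and notation\<close>
  have nonneg: "0 \<le> \<phi> k x" if "x \<in> T" for k x
    using assms(5) that by blast
  have le_A: "\<phi> k x \<le> A" if "x \<in> T" for k x
    unfolding \<open>A = _\<close> using that by (intro cSup_upper[OF _ assms(7)]) auto
  have T_ne: "T \<noteq> {}"
    using \<open>diameter T > 0\<close> by auto
  then obtain x0 where x0: "x0 \<in> T" by blast
  then have A: "0 \<le> A"
    using nonneg[of x0 0] le_A[of x0 0] by linarith
  have r: "r > 0" using \<open>r \<ge> 4\<close> by simp
  \<comment> \<open>Levels are counted by naturals starting at \<open>k0\<close>, so that they can
    be built recursively.\<close>
  define K where "K m = k0 + int m" for m :: nat
  define w where "w k = r powr (- \<beta> * of_int k)" for k
  have w: "w k > 0" for k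
    using r by (simp add: w_def)

  \<comment> \<open>Cutting a single set\<close>
  have step: "\<exists>Q c l. finite Q \<and> partition_on C Q \<and> inj_on l Q \<and>
      (\<forall>D\<in>Q. c D \<in> D \<and> D \<subseteq> cball (c D) (r powi (-(k + 1))) \<and> 1 \<le> l D \<and>
        (\<forall>z\<in>D. \<phi> k x + w k * \<theta> (l D) \<le> \<phi> (k + 2) z + A * \<delta>))"
    if C: "C \<subseteq> T" "C \<subseteq> cball x (r powi (-k))" and x: "x \<in> T" and \<delta>: "0 < \<delta>" for C x k \<delta>
  proof -
    have growth: "\<phi> k x + w k * \<theta> n \<le> Max ((\<lambda>j. \<phi> (k + 2) (y j)) ` {1..n})"
      if "n \<ge> 1" and yC: "\<And>i. i \<in> {1..n} \<Longrightarrow> y i \<in> C"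
        and "\<And>i j. i \<in> {1..n} \<Longrightarrow> j \<in> {1..n} \<Longrightarrow> i \<noteq> j \<Longrightarrow> r powi (-k - 1) \<le> dist (y i) (y j)" for n y
      unfolding w_def
    proof (rule assms(11)[OF x that(1) _ that(3)])
      show "y i \<in> cball x (r powi (-k)) \<inter> T" if "i \<in> {1..n}" for i
        using C that(1) yC by blast
    qed
    \<comment> \<open>From \<open>N\<close> on, \<open>w k * \<theta> n\<close> is at least
      \<open>A + w k\<close>, more than the growth condition can allow when all values of \<phi> lie
      between 0 and \<open>A\<close>.\<close>
    obtain N where N: "\<And>n. N \<le> n \<Longrightarrow> A / w k + 1 \<le> \<theta> n"
      using \<open>filterlim \<theta> at_top sequentially\<close> unfolding filterlim_at_top eventually_sequentially
      by meson
    have bound: "n \<le> N + 1"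
      if y: "\<And>i. i \<in> {1..n} \<Longrightarrow> y i \<in> C"
        "\<And>i j. i \<in> {1..n} \<Longrightarrow> j \<in> {1..n} \<Longrightarrow> i \<noteq> j \<Longrightarrow> r powi (-k - 1) \<le> dist (y i) (y j)" for n y
    proof (rule ccontr)
      assume n: "\<not> n \<le> N + 1"
      have "\<phi> k x + w k * \<theta> n \<le> Max ((\<lambda>j. \<phi> (k + 2) (y j)) ` {1..n})"
        using n y by (intro growth) auto
      also have "\<dots> \<le> A"
      proof (rule Max.boundedI)
        show "v \<le> A" if "v \<in> (\<lambda>j. \<phi> (k + 2) (y j)) ` {1..n}" for v
          using that y(1) C(1) le_A by blast
      qed (use n in auto)
      finally have "w k * \<theta> n \<le> A"
        using nonneg[OF x, of k] by linarith
      moreover have "w k * (A / w k + 1) \<le> w k * \<theta> n"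
        using N[of n] n w[of k] by (intro mult_left_mono) auto
      moreover have "w k * (A / w k + 1) = A + w k"
        using w[of k] by (simp add: field_simps)
      ultimately show False
        using w[of k] by linarith
    qed
    have min: "\<exists>y\<in>S. \<forall>z\<in>S. \<phi> (k + 2) y \<le> \<phi> (k + 2) z + A * \<delta>" if "S \<subseteq> C" "S \<noteq> {}" for S
      using that C(1) \<delta> nonneg le_A by (intro approx_min_exists) auto
    obtain Q c l where Q: "finite Q" "partition_on C Q" "inj_on l Q"
      and D: "\<forall>D\<in>Q. c D \<in> D \<and> D \<subseteq> cball (c D) (r powi (-k - 1)) \<and> (1::nat) \<le> l D \<and>
      (\<exists>y. (\<forall>i\<in>{1..l D}. y i \<in> C) \<and>
        (\<forall>i\<in>{1..l D}. \<forall>j\<in>{1..l D}. i \<noteq> j \<longrightarrow> r powi (-k - 1) \<le> dist (y i) (y j)) \<and>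
        (\<forall>z\<in>D. \<forall>i\<in>{1..l D}. \<phi> (k + 2) (y i) \<le> \<phi> (k + 2) z + A * \<delta>))"
    proof (rule greedy_ball_partition[of "r powi (-k - 1)" C "\<phi> (k + 2)" "A * \<delta>" "N + 1"])
      show "n \<le> N + 1" if "\<And>i. i \<in> {1..n} \<Longrightarrow> y i \<in> C"
        "\<And>i j. i \<in> {1..n} \<Longrightarrow> j \<in> {1..n} \<Longrightarrow> i \<noteq> j \<Longrightarrow> r powi (-k - 1) \<le> dist (y i) (y j)" for n y
        using that by (rule bound)
    qed (use r in simp, erule (1) min, rule that, assumption+)
    \<comment> \<open>Growth for the first \<open>l D\<close> centres bounds the left side by the
      largest value of \<open>\<phi> (k + 2)\<close> among them; near minimality compares each of
      these values with the one at \<open>z\<close>.\<close>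
    have "\<phi> k x + w k * \<theta> (l D) \<le> \<phi> (k + 2) z + A * \<delta>" if Dz: "D \<in> Q" "z \<in> D" for D z
    proof -
      obtain y where l1: "1 \<le> l D" and y: "\<And>i. i \<in> {1..l D} \<Longrightarrow> y i \<in> C"
        "\<And>i j. i \<in> {1..l D} \<Longrightarrow> j \<in> {1..l D} \<Longrightarrow> i \<noteq> j \<Longrightarrow> r powi (-k - 1) \<le> dist (y i) (y j)"
        "\<And>i. i \<in> {1..l D} \<Longrightarrow> \<phi> (k + 2) (y i) \<le> \<phi> (k + 2) z + A * \<delta>"
        using bspec[OF D Dz(1)] Dz(2) by blast
      have "\<phi> k x + w k * \<theta> (l D) \<le> Max ((\<lambda>j. \<phi> (k + 2) (y j)) ` {1..l D})"
        using growth[OF l1 y(1,2)] .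
      also have "\<dots> \<le> \<phi> (k + 2) z + A * \<delta>"
        using l1 y(3) by (subst Max_le_iff) auto
      finally show ?thesis .
    qed
    then have "\<forall>D\<in>Q. c D \<in> D \<and> D \<subseteq> cball (c D) (r powi (-k - 1)) \<and> 1 \<le> l D \<and>
        (\<forall>z\<in>D. \<phi> k x + w k * \<theta> (l D) \<le> \<phi> (k + 2) z + A * \<delta>)"
      using D by simp
    moreover have "-k - 1 = -(k + 1)"
      by simp
    ultimately show ?thesis
      using Q by metis
  qed

  \<comment> \<open>Construction of the levels by dependent choice\<close>
  define good where "good m = (\<lambda>(P, c, l). finite P \<and> partition_on T P \<and>
      (\<forall>C\<in>P. c C \<in> C \<and> C \<subseteq> cball (c C) (r powi (-K m)) \<and> (1::nat) \<le> l C))"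
    for m :: nat
  \<comment> \<open>A state consists of a partition, its centres and its labels; \<open>good\<close>
    concerns one level and \<open>adv\<close> links consecutive ones. The slacks
    \<open>A * (1/2) ^ Suc m\<close> have total at most \<open>A\<close>.\<close>
  define adv where "adv m = (\<lambda>(P, c :: 'a set \<Rightarrow> 'a, l :: 'a set \<Rightarrow> nat) (P', c' :: 'a set \<Rightarrow> 'a, l').
      refines T P' P \<and> (\<forall>C\<in>P. inj_on l' {D\<in>P'. D \<subseteq> C} \<and> (\<forall>D\<in>P'. D \<subseteq> C \<longrightarrow>
        (\<forall>z\<in>D. \<phi> (K m) (c C) + w (K m) * \<theta> (l' D) \<le> \<phi> (K m + 2) z + A * (1/2) ^ Suc m))))"
    for m :: nat
  have "\<exists>s. \<forall>m. good m (s m) \<and> adv m (s m) (s (Suc m))"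
  proof (rule dependent_nat_choice[where P = good and Q = adv])
    \<comment> \<open>The first level is \<open>{T}\<close>, and any point of \<open>T\<close> can
      be its centre because the diameter is at most \<open>r powi (-k0)\<close>. Its label 1 is a
      default: the sum and the distinctness condition only read labels from level
      \<open>k0 + 1\<close> on.\<close>
    have "T \<subseteq> cball x0 (r powi (-k0))"
      using diameter_bounded_bound[OF \<open>bounded T\<close> x0] \<open>diameter T \<le> _\<close> by fastforce
    then show "\<exists>s. good 0 s"
      using x0 T_ne by (intro exI[of _ "({T}, \<lambda>_. x0, \<lambda>_. 1)"]) (auto simp: good_def K_def partition_on_space)
  next
    fix s m
    assume s: "good m s"
    obtain P c l where [simp]: "s = (P, c, l)" by (cases s)
    have P: "finite P" "partition_on T P" "\<And>C. C \<in> P \<Longrightarrow> c C \<in> C \<and> C \<subseteq> cball (c C) (r powi (-K m))"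
      using s by (auto simp: good_def)
    have P_T: "C \<subseteq> T" if "C \<in> P" for C
      using P(2) that by (auto simp: partition_on_def)
    have K_Suc: "K m + 1 = K (Suc m)"
      by (simp add: K_def)
    have "\<exists>P' c' l'. finite P' \<and> refines T P' P \<and>
      (\<forall>C\<in>P. inj_on l' {D\<in>P'. D \<subseteq> C} \<and> (\<forall>D\<in>P'. D \<subseteq> C \<longrightarrow>
        c' D \<in> D \<and> D \<subseteq> cball (c' D) (r powi (-K (Suc m))) \<and> (1::nat) \<le> l' D \<and>
        (\<forall>z\<in>D. \<phi> (K m) (c C) + w (K m) * \<theta> (l' D) \<le> \<phi> (K m + 2) z + A * (1/2) ^ Suc m)))"
    proof (rule partition_refine_each[OF P(2,1), where R = "\<lambda>C D y n.
        y \<in> D \<and> D \<subseteq> cball y (r powi (-K (Suc m))) \<and> (1::nat) \<le> n \<and>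
        (\<forall>z\<in>D. \<phi> (K m) (c C) + w (K m) * \<theta> n \<le> \<phi> (K m + 2) z + A * (1/2) ^ Suc m)"])
      fix C assume C: "C \<in> P"
      have "c C \<in> T" using P(3)[OF C] P_T[OF C] by blast
      then show "\<exists>Q c' l'. finite Q \<and> partition_on C Q \<and> inj_on l' Q \<and> (\<forall>D\<in>Q.
        c' D \<in> D \<and> D \<subseteq> cball (c' D) (r powi (-K (Suc m))) \<and> (1::nat) \<le> l' D \<and>
        (\<forall>z\<in>D. \<phi> (K m) (c C) + w (K m) * \<theta> (l' D) \<le> \<phi> (K m + 2) z + A * (1/2) ^ Suc m))"
        using step[of C "c C" "K m" "(1/2) ^ Suc m"] P(3)[OF C] P_T[OF C] unfolding K_Suc by simp
    qed
    then obtain P' c' l' where P': "finite P'" "refines T P' P"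
      "\<forall>C\<in>P. inj_on l' {D\<in>P'. D \<subseteq> C} \<and> (\<forall>D\<in>P'. D \<subseteq> C \<longrightarrow>
        c' D \<in> D \<and> D \<subseteq> cball (c' D) (r powi (-K (Suc m))) \<and> (1::nat) \<le> l' D \<and>
        (\<forall>z\<in>D. \<phi> (K m) (c C) + w (K m) * \<theta> (l' D) \<le> \<phi> (K m + 2) z + A * (1/2) ^ Suc m))"
      by (elim exE conjE)
    have "c' D \<in> D \<and> D \<subseteq> cball (c' D) (r powi (-K (Suc m))) \<and> 1 \<le> l' D" if D: "D \<in> P'" for D
    proof -
      obtain C where "C \<in> P" "D \<subseteq> C"
        using P'(2) D by (auto simp: refines_def)
      then show ?thesis
        using P'(3) D by simp
    qed
    then have "good (Suc m) (P', c', l')"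
      unfolding good_def prod.case using P'(1,2) by (simp add: refines_def)
    moreover have "adv m s (P', c', l')"
      unfolding adv_def \<open>s = _\<close> prod.case using P'(2,3) by simp
    ultimately show "\<exists>s'. good (Suc m) s' \<and> adv m s s'" by blast
  qed
  then obtain s where s: "\<And>m. good m (s m)" "\<And>m. adv m (s m) (s (Suc m))" by blast

  \<comment> \<open>Partitions, centres and labels of all levels\<close>
  define P where "P m = fst (s m)" for m
  define c where "c m = fst (snd (s m))" for m
  define L where "L m = snd (snd (s m))" for m
  have s_eq: "s m = (P m, c m, L m)" for m
    by (simp add: P_def c_def L_def)
  have fin: "finite (P m)" and part: "partition_on T (P m)"
    and ctr: "C \<in> P m \<Longrightarrow> c m C \<in> C \<and> C \<subseteq> cball (c m C) (r powi (-K m)) \<and> 1 \<le> L m C" for m C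
    using s(1)[of m] by (auto simp: good_def s_eq)
  have ref: "refines T (P (Suc m)) (P m)"
    and inj: "C \<in> P m \<Longrightarrow> inj_on (L (Suc m)) {D\<in>P (Suc m). D \<subseteq> C}"
    and gain: "\<lbrakk>C \<in> P m; D \<in> P (Suc m); D \<subseteq> C; z \<in> D\<rbrakk> \<Longrightarrow>
      \<phi> (K m) (c m C) + w (K m) * \<theta> (L (Suc m) D) \<le> \<phi> (K m + 2) z + A * (1/2) ^ Suc m" for m C D z
    using s(2)[of m] by (auto simp: adv_def s_eq)
  \<comment> \<open>Back to integer levels. Below \<open>k0\<close> the truncation by
    \<open>nat\<close> repeats the first level, a default value that the theorem never
    inspects.\<close>
  define \<C> where "\<C> k = P (nat (k - k0))" for k
  define l where "l k = L (nat (k - k0))" for k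
  have nat_Suc: "nat (k + 1 - k0) = Suc (nat (k - k0))" and K_nat: "K (nat (k - k0)) = k" if "k0 \<le> k" for k
    using that by (auto simp: K_def)

  \<comment> \<open>Bounding the sum along a branch\<close>
  have sum_bound: "(\<Sum>m<M. w (K m) * \<theta> (l (K m + 1) (cell (\<C> (K m + 1)) x))) \<le> 4 * A"
    if x: "x \<in> T" for x M
  proof -
    define E where "E m = cell (P m) x" for m
    have E: "E m \<in> P m" "x \<in> E m" for m
      using cell_in[OF part x] by (auto simp: E_def)
    have E_mono: "E (Suc m) \<subseteq> E m" for m
    proof -
      obtain C where C: "C \<in> P m" "E (Suc m) \<subseteq> C"
        using ref[of m] E(1)[of "Suc m"] by (auto simp: refines_def)
      \<comment> \<open>The parent of \<open>E (Suc m)\<close> contains \<open>x\<close>, and only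
        one set of \<open>P m\<close> does.\<close>
      then have "E m = C"
        using cell_eq[OF part, of C m x] E(2)[of "Suc m"] by (auto simp: E_def)
      with C show ?thesis by simp
    qed
    define g where "g m = \<phi> (K m) (c m (E m))" for m
    have "c m (E m) \<in> T" for m
      using ctr[OF E(1)[of m]] E(1)[of m] part[of m] by (auto simp: partition_on_def)
    then have g: "0 \<le> g m" "g m \<le> A" for m
      using nonneg le_A by (auto simp: g_def)
    have gain_E: "w (K m) * \<theta> (l (K m + 1) (cell (\<C> (K m + 1)) x))
        \<le> (g (m + 2) - g m) + A * (1/2) ^ Suc m" for m
    proof -
      \<comment> \<open>The point \<open>z\<close> in \<open>gain\<close> is taken to be the centre
        two levels down: there \<open>\<phi> (K m + 2)\<close> is exactly the function defining
        \<open>g (m + 2)\<close>, and \<open>E (m + 2)\<close> lies in the piece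
        \<open>E (Suc m)\<close>.\<close>
      have "c (m + 2) (E (m + 2)) \<in> E (Suc m)"
        using ctr[OF E(1)[of "m + 2"]] E_mono[of "Suc m"] by auto
      then have "g m + w (K m) * \<theta> (L (Suc m) (E (Suc m))) \<le> g (m + 2) + A * (1/2) ^ Suc m"
        by (auto dest!: gain[OF E(1) E(1) E_mono] simp: g_def K_def algebra_simps)
      moreover have "l (K m + 1) (cell (\<C> (K m + 1)) x) = L (Suc m) (E (Suc m))"
        by (simp add: l_def \<C>_def E_def K_def nat_add_distrib)
      ultimately show ?thesis by simp
    qed
    have "(\<Sum>m<M. w (K m) * \<theta> (l (K m + 1) (cell (\<C> (K m + 1)) x)))
        \<le> (\<Sum>m<M. (g (m + 2) - g m) + A * (1/2) ^ Suc m)"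
      by (intro sum_mono gain_E)
    also have "\<dots> = (g M + g (Suc M) - g 0 - g 1) + A * (\<Sum>m<M. (1/2) ^ Suc m)"
      by (simp only: sum.distrib sum_telescope_two sum_distrib_left)
    also have "(\<Sum>m<M. (1/2::real) ^ Suc m) = 1 - (1/2) ^ M"
      by (induction M) (auto simp: field_simps)
    also have "A * (1 - (1/2) ^ M) \<le> A * 1"
      using A by (intro mult_left_mono) auto
    \<comment> \<open>The two top values contribute at most \<open>2 * A\<close>, the two bottom
      ones at most 0 and the slack at most \<open>A\<close>.\<close>
    finally show ?thesis
      using g[of M] g[of "Suc M"] g[of 0] g[of 1] A by linarith
  qed
  have summ: "(\<lambda>k. w k * \<theta> (l (k + 1) (cell (\<C> (k + 1)) x))) summable_on {k0..} \<and>
      (\<Sum>\<^sub>\<infinity>k\<in>{k0..}. w k * \<theta> (l (k + 1) (cell (\<C> (k + 1)) x))) \<le> 4 * A" if x: "x \<in> T" for x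
  proof -
    \<comment> \<open>Nonnegativity of \<theta> is given only for arguments at least 1, which
      \<open>ctr\<close> guarantees for the labels.\<close>
    have nn: "0 \<le> w k * \<theta> (l (k + 1) (cell (\<C> (k + 1)) x))" if "k0 \<le> k" for k
      using ctr[OF cell_in(1)[OF part x]] w[of k] assms(9)
      by (intro mult_nonneg_nonneg) (auto simp: l_def \<C>_def)
    show ?thesis
      using summable_on_infsum_le_int_atLeast[of k0 "\<lambda>k. w k * \<theta> (l (k + 1) (cell (\<C> (k + 1)) x))", OF nn]
        sum_bound[OF x] unfolding K_def by blast
  qed

  \<comment> \<open>Diameters and conclusion\<close>
  have diam: "diameter C \<le> 2 * r powi (-k)" if "k0 \<le> k" "C \<in> \<C> k" for k C
  proof (rule diameter_le_dist)
    have C: "C \<in> P (nat (k - k0))"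
      using that by (simp add: \<C>_def)
    note ball = ctr[OF C, unfolded K_nat[OF that(1)]]
    show "C \<noteq> {}" using ball by blast
    fix y z assume "y \<in> C" "z \<in> C"
    then have "dist (c (nat (k - k0)) C) y \<le> r powi (-k)" "dist (c (nat (k - k0)) C) z \<le> r powi (-k)"
      using ball by auto
    then show "dist y z \<le> 2 * r powi (-k)"
      using dist_triangle3[of y z "c (nat (k - k0)) C"] by linarith
  qed
  show ?thesis
  proof (intro exI[of _ \<C>] exI[of _ l] conjI ballI allI impI)
    show "finite (\<C> k)" "partition_on T (\<C> k)" for k
      using fin part by (auto simp: \<C>_def)
    show "refines T (\<C> (k + 1)) (\<C> k)" if "k \<ge> k0" for k
      using ref by (simp add: \<C>_def nat_Suc[OF that])
    show "1 \<le> l k C" if "k \<ge> k0" "C \<in> \<C> k" for k C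
      using ctr that by (simp add: \<C>_def l_def)
    show "diameter C \<le> 2 * r powi (-k)" if "k \<ge> k0" "C \<in> \<C> k" for k C
      using diam that .
    show "l (k + 1) C \<noteq> l (k + 1) D"
      if "k \<ge> k0" "E \<in> \<C> k" "C \<in> \<C> (k + 1)" "D \<in> \<C> (k + 1)" "C \<noteq> D \<and> C \<subseteq> E \<and> D \<subseteq> E" for k E C D
      using that inj[of E "nat (k - k0)"] by (auto simp: \<C>_def l_def nat_Suc dest: inj_onD)
  qed (use summ in \<open>simp_all add: w_def\<close>)
qed

end
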